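(* Let $M, K \in \mathbb{R}^{n\times n}$ be symmetric positive definite matrices with Cholesky factorizations $M = L_2 L_2^*$, $K = L_1 L_1^*$, and let $L_2^{-1}L_1 = U_2 \Omega U_1^*$ be a singular value decomposition, with $\Omega = \operatorname{diag}(\omega_1,\dots,\omega_n)$, $\omega_i > 0$. For $\widetilde D \in \mathbb{R}^{n\times n}$ put $$\widetilde A = \widetilde A(\widetilde D) = \begin{bmatrix} 0 & \Omega \\ -\Omega & -\widetilde D\end{bmatrix} \in \mathbb{R}^{2n\times 2n},$$ and let $$\mathcal{D}_s = \{\widetilde D \in \mathbb{R}^{n\times n} : \widetilde D \text{ symmetric positive semidefinite and } \widetilde A(\widetilde D) \text{ stable}\}.$$ Then for every $0 < p < 1$ there exists a unique global minimum (that is, a unique minimizer $\widetilde D$) of the optimization problem $$\text{minimize } \sqrt{\operatorname{Tr}(X)} \quad \text{subject to}\quad \widetilde A X + X \widetilde A^* = -\begin{bmatrix} pI & 0 \\ 0 & I\end{bmatrix} \ \text{ and }\ \widetilde D \in \mathcal{D}_s,$$ and the minimum is attained at $\widetilde D = \sqrt{\frac{2(1+p)}{p}}\,\Omega$.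
   Context: A square matrix is called stable if all its eigenvalues have strictly negative real part; for $\widetilde D \in \mathcal{D}_s$ the Lyapunov equation above has a unique solution $X = X(\widetilde D)$, so the problem is a minimization over $\widetilde D \in \mathcal{D}_s$. $I$ denotes the $n\times n$ identity matrix and ${}^*$ denotes the (conjugate) transpose. Background: $\widetilde A$ is the system matrix of the vibrational system $M\ddot q + D\dot q + Kq = B_2 u$ in the coordinates $x_1 = U_1^*L_1^* q$, $x_2 = U_2^* L_2^* \dot q$, where $\widetilde D = U_2^* L_2^{-1} D L_2^{-*} U_2$. *)

theory Defs
  imports Complex_Main "Jordan_Normal_Form.Matrix" "Jordan_Normal_Form.Char_Poly"
begin

text \<open>
  All matrices of the problem are real, so the (conjugate) transpose is the plain transpose.
\<close>

definition mtrace :: "'a :: comm_monoid_add mat \<Rightarrow> 'a" where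
  "mtrace A = (\<Sum>i<dim_row A. A $$ (i, i))"

definition sym_pos_def :: "nat \<Rightarrow> real mat \<Rightarrow> bool" where
  "sym_pos_def n A \<longleftrightarrow> A \<in> carrier_mat n n \<and> A\<^sup>T = A \<and>
     (\<forall>x \<in> carrier_vec n. x \<noteq> 0\<^sub>v n \<longrightarrow> x \<bullet> (A *\<^sub>v x) > 0)"

definition sym_pos_semidef :: "nat \<Rightarrow> real mat \<Rightarrow> bool" where
  "sym_pos_semidef n A \<longleftrightarrow> A \<in> carrier_mat n n \<and> A\<^sup>T = A \<and>
     (\<forall>x \<in> carrier_vec n. x \<bullet> (A *\<^sub>v x) \<ge> 0)"

definition cholesky_factor :: "nat \<Rightarrow> real mat \<Rightarrow> real mat \<Rightarrow> bool" where
  "cholesky_factor n A L \<longleftrightarrow> L \<in> carrier_mat n n \<and> upper_triangular (L\<^sup>T) \<and>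
     (\<forall>i<n. L $$ (i, i) > 0) \<and> A = L * L\<^sup>T"

text \<open>
  The library's \<^const>\<open>orthogonal_mat\<close> only asks for pairwise orthogonal nonzero columns, without
  normalization, so it is not the notion needed for singular vectors.
\<close>

definition orthonormal_mat :: "nat \<Rightarrow> real mat \<Rightarrow> bool" where
  "orthonormal_mat n U \<longleftrightarrow> U \<in> carrier_mat n n \<and> U\<^sup>T * U = 1\<^sub>m n \<and> U * U\<^sup>T = 1\<^sub>m n"

text \<open>The eigenvalues of a real matrix are its complex ones, hence the embedding.\<close>

definition stable_mat :: "real mat \<Rightarrow> bool" where
  "stable_mat A \<longleftrightarrow> square_mat A \<and>
     (\<forall>k :: complex. eigenvalue (map_mat complex_of_real A) k \<longrightarrow> Re k < 0)"

definition system_mat :: "nat \<Rightarrow> real mat \<Rightarrow> real mat \<Rightarrow> real mat" where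
  "system_mat n \<Omega> D = four_block_mat (0\<^sub>m n n) \<Omega> (- \<Omega>) (- D)"

definition stable_dampings :: "nat \<Rightarrow> real mat \<Rightarrow> real mat set" where
  "stable_dampings n \<Omega> = {D. sym_pos_semidef n D \<and> stable_mat (system_mat n \<Omega> D)}"

definition lyapunov_solution :: "nat \<Rightarrow> real \<Rightarrow> real mat \<Rightarrow> real mat \<Rightarrow> real mat \<Rightarrow> bool" where
  "lyapunov_solution n p \<Omega> D X \<longleftrightarrow> X \<in> carrier_mat (2 * n) (2 * n) \<and>
     system_mat n \<Omega> D * X + X * (system_mat n \<Omega> D)\<^sup>T =
       - four_block_mat (p \<cdot>\<^sub>m 1\<^sub>m n) (0\<^sub>m n n) (0\<^sub>m n n) (1\<^sub>m n)"

text \<open>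
  The constrained problem, with variables \<open>D\<close> and \<open>X\<close>. Since \<open>X\<close> is determined by \<open>D\<close> on the
  feasible set, a minimizer in the sense of the problem is the \<open>D\<close>-component of an optimal pair.
\<close>

definition optimal_damping :: "nat \<Rightarrow> real \<Rightarrow> real mat \<Rightarrow> real mat \<Rightarrow> bool" where
  "optimal_damping n p \<Omega> D \<longleftrightarrow>
     (\<exists>X. is_arg_min (\<lambda>(D, X). sqrt (mtrace X))
            (\<lambda>(D, X). D \<in> stable_dampings n \<Omega> \<and> lyapunov_solution n p \<Omega> D X) (D, X))"

end

theory Submission
  imports Defs
begin

text \<open>
  Split a symmetric solution \<open>X\<close> into blocks. The upper left block of the Lyapunov equation says that
  \<open>X\<^sub>1\<^sub>2 = (S - (p/2) I) \<Omega>\<^sup>-\<^sup>1\<close> with \<open>S\<close> skew-symmetric. With \<open>Z = X\<^sub>2\<^sub>2\<close> and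
  \<open>P = \<Omega>\<^sup>-\<^sup>1 D \<Omega>\<^sup>-\<^sup>1\<close>, the remaining blocks give \<open>Tr X = 2 Tr Z + (p/2) Tr P\<close>,
  \<open>(D Z)\<^sub>i\<^sub>i = (1 + p)/2\<close> and \<open>Tr (Z D Z) = (1 + p)/2 Tr Z - Tr (S\<^sup>T P S)\<close>. Completing the square with
  \<open>t\<^sup>2 = p (1 + p)/8\<close> and \<open>W = Z - t \<Omega>\<^sup>-\<^sup>1\<close>,
  \<open>Tr X - 4 t Tr \<Omega>\<^sup>-\<^sup>1 = 4/(1 + p) (Tr (W D W) + Tr (S\<^sup>T P S)) \<ge> 0\<close>.

  In the case of equality \<open>D W = 0\<close> and \<open>P S = 0\<close>, which forces \<open>Z\<close> and hence \<open>W\<close> to commute with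
  \<open>\<Omega>\<close>. A nonzero column of \<open>W\<close> would then be an undamped eigenvector of \<open>\<Omega>\<close>, contradicting
  stability. So \<open>Z = t \<Omega>\<^sup>-\<^sup>1\<close>, which gives \<open>D = (1 + p)/(2 t) \<Omega> + (S \<Omega> - \<Omega> S)/t\<close>, and the trace of
  \<open>D \<Omega>\<^sup>-\<^sup>1 S = 0\<close> shows that the commutator vanishes.
\<close>

section \<open>Trace bound for the blocks of a symmetric solution\<close>

text \<open>With \<open>y = D x\<close>, the form at \<open>x - e y\<close> is
  \<open>e * e * q - 2 * e * a\<close>, where \<open>a\<close> is the squared norm of
  \<open>y\<close> and \<open>q\<close> is the form at \<open>y\<close>. A small positive
  \<open>e\<close> would make this negative unless \<open>a = 0\<close>.\<close>

lemma psd_form_zero_imp_kernel: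
  fixes D :: "nat \<Rightarrow> nat \<Rightarrow> real"
  assumes sym: "\<And>i j. i < n \<Longrightarrow> j < n \<Longrightarrow> D i j = D j i"
    and psd: "\<And>x. 0 \<le> (\<Sum>i<n. x i * (\<Sum>j<n. D i j * x j))"
    and zero: "(\<Sum>i<n. x i * (\<Sum>j<n. D i j * x j)) = 0"
    and "i < n"
  shows "(\<Sum>j<n. D i j * x j) = 0"
proof -
  define y where "y i = (\<Sum>j<n. D i j * x j)" for i
  define z where "z i = (\<Sum>j<n. D i j * y j)" for i
  define a where "a = (\<Sum>i<n. y i * y i)"
  define q where "q = (\<Sum>i<n. y i * z i)"
  have xz: "(\<Sum>i<n. x i * z i) = a"
  proof -
    have "(\<Sum>i<n. x i * z i) = (\<Sum>i<n. \<Sum>j<n. x i * D i j * y j)"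
      by (simp add: z_def sum_distrib_left mult.assoc)
    also have "\<dots> = (\<Sum>j<n. \<Sum>i<n. x i * D i j * y j)"
      by (rule sum.swap)
    also have "\<dots> = (\<Sum>j<n. y j * y j)"
      unfolding y_def sum_distrib_left
      by (intro sum.cong refl) (use sym in \<open>auto simp: sum_distrib_left sum_distrib_right mult_ac\<close>)
    finally show ?thesis by (simp add: a_def)
  qed
  have form: "0 \<le> e * e * q - 2 * e * a" for e
  proof -
    have "0 \<le> (\<Sum>i<n. (x i - e * y i) * (\<Sum>j<n. D i j * (x j - e * y j)))"
      by (rule psd)
    also have "\<dots> = (\<Sum>i<n. (x i - e * y i) * (y i - e * z i))"
      by (simp add: y_def z_def algebra_simps sum_subtractf sum_distrib_left)
    also have "\<dots> = (\<Sum>i<n. x i * y i) - e * (\<Sum>i<n. x i * z i) - e * a + e * e * q"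
      by (simp add: a_def q_def algebra_simps sum_subtractf sum.distrib sum_distrib_left)
    also have "\<dots> = e * e * q - 2 * e * a"
      using zero xz by (simp add: y_def)
    finally show ?thesis .
  qed
  have q: "0 \<le> q"
    unfolding q_def z_def by (rule psd)
  have a: "0 \<le> a"
    unfolding a_def by (intro sum_nonneg) auto
  have "a = 0"
  proof (rule ccontr)
    assume "a \<noteq> 0"
    then have a': "0 < a" using a by simp
    \<comment> \<open>The denominator \<open>q + 1\<close> stays positive even for
      \<open>q = 0\<close>, and this \<open>e\<close> is small enough for
      \<open>e * q < 2 * a\<close>.\<close>
    define e where "e = a / (q + 1)"
    have e: "0 < e" using a' q by (simp add: e_def)
    have "e * q < 2 * a"
      using a' q by (simp add: e_def field_simps) (smt (verit) mult_nonneg_nonneg)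
    then have "e * (e * q) < e * (2 * a)" using e by simp
    with form[of e] show False by (simp add: mult.assoc mult.left_commute)
  qed
  then have "y i * y i = 0"
    unfolding a_def using \<open>i < n\<close> by (subst (asm) sum_nonneg_eq_0_iff) auto
  then show ?thesis by (simp add: y_def)
qed

text \<open>Entrywise form of the Lyapunov equation for a symmetric solution with blocks
  \<open>X\<^sub>1\<^sub>1 = T\<close>, \<open>X\<^sub>1\<^sub>2 = Y\<close>, \<open>X\<^sub>2\<^sub>2 = Z\<close>.\<close>

locale lyapunov_blocks =
  fixes n :: nat and \<omega> :: "nat \<Rightarrow> real" and p :: real and D T Y Z :: "nat \<Rightarrow> nat \<Rightarrow> real"
  assumes \<omega>_pos: "i < n \<Longrightarrow> 0 < \<omega> i"
    and p_pos: "0 < p"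
    and D_sym: "i < n \<Longrightarrow> j < n \<Longrightarrow> D i j = D j i"
    and D_psd: "0 \<le> (\<Sum>i<n. x i * (\<Sum>j<n. D i j * x j))"
    and T_sym: "i < n \<Longrightarrow> j < n \<Longrightarrow> T i j = T j i"
    and Z_sym: "i < n \<Longrightarrow> j < n \<Longrightarrow> Z i j = Z j i"
    and eq11: "i < n \<Longrightarrow> j < n \<Longrightarrow> \<omega> i * Y j i + Y i j * \<omega> j = (if i = j then - p else 0)"
    and eq12: "i < n \<Longrightarrow> j < n \<Longrightarrow> \<omega> i * Z i j - T i j * \<omega> j - (\<Sum>k<n. Y i k * D k j) = 0"
    and eq22: "i < n \<Longrightarrow> j < n \<Longrightarrow>
      - (\<omega> i * Y i j) - (\<Sum>k<n. D i k * Z k j) - Y j i * \<omega> j - (\<Sum>k<n. Z i k * D k j)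
        = (if i = j then - 1 else 0)"
begin

text \<open>As matrices, \<open>S = Y \<Omega> + (p/2) I\<close>, \<open>G = Z D\<close>, \<open>H = S \<Omega>\<^sup>-\<^sup>1 D \<Omega>\<^sup>-\<^sup>1\<close> and
  \<open>W t = Z - t \<Omega>\<^sup>-\<^sup>1\<close>, where \<open>D\<close>, \<open>T\<close>, \<open>Z\<close> are symmetric.\<close>

definition S :: "nat \<Rightarrow> nat \<Rightarrow> real" where
  "S i j = Y i j * \<omega> j + (if i = j then p / 2 else 0)"

definition G :: "nat \<Rightarrow> nat \<Rightarrow> real" where
  "G i j = (\<Sum>k<n. D j k * Z i k)"

definition H :: "nat \<Rightarrow> nat \<Rightarrow> real" where
  "H i j = (\<Sum>k<n. D j k * (S i k / \<omega> k)) / \<omega> j"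

definition W :: "real \<Rightarrow> nat \<Rightarrow> nat \<Rightarrow> real" where
  "W t i j = Z i j - (if i = j then t / \<omega> i else 0)"

section \<open>Elimination of the blocks \<open>Y\<close> and \<open>T\<close>\<close>

lemma \<omega>_nz: "i < n \<Longrightarrow> \<omega> i \<noteq> 0"
  using \<omega>_pos by fastforce

lemma S_skew: "i < n \<Longrightarrow> j < n \<Longrightarrow> S j i = - S i j"
  using eq11[of i j] by (auto simp: S_def algebra_simps)

lemma Y_eq: "i < n \<Longrightarrow> j < n \<Longrightarrow> Y i j = S i j / \<omega> j - (if i = j then p / 2 / \<omega> i else 0)"
  using \<omega>_nz by (auto simp: S_def field_simps)

text \<open>This is the lower right block with \<open>Y\<close> replaced by \<open>S\<close>; the
  summand \<open>p\<close> stems from the diagonal part of \<open>Y\<close>. On the diagonal the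
  \<open>S\<close> term vanishes, so the diagonal of \<open>Z D\<close> is the same for every
  damping.\<close>

lemma G_plus_G:
  assumes "i < n" "j < n"
  shows "G i j + G j i = (if i = j then 1 + p else 0) + S i j * (\<omega> j / \<omega> i - \<omega> i / \<omega> j)"
proof -
  have 1: "(\<Sum>k<n. D i k * Z k j) = G j i"
    unfolding G_def using assms by (intro sum.cong refl) (simp add: Z_sym)
  have 2: "(\<Sum>k<n. Z i k * D k j) = G i j"
    unfolding G_def using assms by (intro sum.cong refl) (simp add: D_sym)
  have "G i j + G j i = (if i = j then 1 else 0) - \<omega> i * Y i j - \<omega> j * Y j i"
    using eq22[OF assms] unfolding 1 2 by (simp add: algebra_simps split: if_splits)
  then show ?thesis
    using assms \<omega>_nz[of i] \<omega>_nz[of j] S_skew[of i j]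
    by (auto simp: Y_eq field_simps)
qed

lemma G_diag: "i < n \<Longrightarrow> G i i = (1 + p) / 2"
  using G_plus_G[of i i] by simp

text \<open>The upper right block solved for \<open>T\<close>: the skew part of
  \<open>Y \<Omega>\<close> produces \<open>H\<close>, its diagonal part the term with
  \<open>p / 2\<close>.\<close>

lemma T_eq:
  assumes "i < n" "j < n"
  shows "T i j = \<omega> i / \<omega> j * Z i j - H i j + p / 2 * (D i j / (\<omega> i * \<omega> j))"
proof -
  have "(\<Sum>k<n. Y i k * D k j)
      = (\<Sum>k<n. D j k * (S i k / \<omega> k) - (if i = k then p / 2 / \<omega> i * D i j else 0))"
    using assms by (intro sum.cong refl) (auto simp: Y_eq D_sym algebra_simps)
  also have "\<dots> = \<omega> j * H i j - p / 2 / \<omega> i * D i j"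
    using assms \<omega>_nz[of j] by (simp add: sum_subtractf H_def)
  finally show ?thesis
    using eq12[OF assms] \<omega>_nz[OF assms(1)] \<omega>_nz[OF assms(2)] by (simp add: field_simps)
qed

text \<open>The sum pairs the symmetric matrix with entries
  \<open>D i k / (\<omega> i * \<omega> k)\<close> with the skew matrix \<open>S\<close>, so
  swapping the indices negates it.\<close>

lemma sum_H_diag: "(\<Sum>i<n. H i i) = 0"
proof -
  have "(\<Sum>i<n. H i i) = (\<Sum>i<n. \<Sum>k<n. D i k * S i k / (\<omega> i * \<omega> k))"
    by (simp add: H_def sum_divide_distrib mult.commute)
  also have "\<dots> = (\<Sum>i<n. \<Sum>k<n. - (D k i * S k i / (\<omega> k * \<omega> i)))"
  proof (intro sum.cong refl)
    fix i k assume "i \<in> {..<n}" "k \<in> {..<n}"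
    then show "D i k * S i k / (\<omega> i * \<omega> k) = - (D k i * S k i / (\<omega> k * \<omega> i))"
      using D_sym[of i k] S_skew[of i k] by (simp add: mult.commute)
  qed
  also have "\<dots> = - (\<Sum>k<n. \<Sum>i<n. D k i * S k i / (\<omega> k * \<omega> i))"
    by (subst sum.swap) (simp add: sum_negf)
  also have "\<dots> = - (\<Sum>i<n. H i i)"
    by (simp add: H_def sum_divide_distrib mult.commute)
  finally show ?thesis by simp
qed

lemma trace_eq:
  "(\<Sum>i<n. T i i) + (\<Sum>i<n. Z i i)
    = 2 * (\<Sum>i<n. Z i i) + p / 2 * (\<Sum>i<n. D i i / (\<omega> i * \<omega> i))"
proof -
  have "(\<Sum>i<n. T i i) = (\<Sum>i<n. Z i i - H i i + p / 2 * (D i i / (\<omega> i * \<omega> i)))"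
    using \<omega>_nz by (intro sum.cong refl) (simp add: T_eq)
  then show ?thesis
    using sum_H_diag by (simp add: sum.distrib sum_subtractf sum_distrib_left)
qed

text \<open>Since \<open>T\<close> is symmetric, the skew part of the formula \<open>T_eq\<close>
  vanishes. The frequency factor is the one in \<open>G_plus_G\<close>, so \<open>Z\<close> times
  the \<open>S\<close> term there can be rewritten through \<open>H\<close>.\<close>

lemma Z_commutator:
  assumes "i < n" "j < n"
  shows "Z i j * (\<omega> j / \<omega> i - \<omega> i / \<omega> j) = H j i - H i j"
  using T_sym[OF assms] assms Z_sym[OF assms] D_sym[OF assms] T_eq[OF assms] T_eq[OF assms(2,1)]
  by (simp add: algebra_simps)

text \<open>The symmetric \<open>Z\<close> sees only the symmetric part of \<open>G\<close>, which
  \<open>G_plus_G\<close> provides. Its diagonal gives the trace of \<open>Z\<close>;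
  \<open>Z_commutator\<close> turns the rest into \<open>S\<close> paired with
  \<open>H j i - H i j\<close>, and skewness of \<open>S\<close> makes the two halves equal.\<close>

lemma energy_identity:
  "(\<Sum>i<n. \<Sum>j<n. Z i j * G i j)
    = (1 + p) / 2 * (\<Sum>i<n. Z i i) - (\<Sum>i<n. \<Sum>j<n. S i j * H i j)"
proof -
  have swapZ: "(\<Sum>i<n. \<Sum>j<n. Z i j * G i j) = (\<Sum>i<n. \<Sum>j<n. Z i j * G j i)"
    by (subst (2) sum.swap, intro sum.cong refl) (use Z_sym in fastforce)
  have swapS: "(\<Sum>i<n. \<Sum>j<n. S i j * H j i) = - (\<Sum>i<n. \<Sum>j<n. S i j * H i j)"
  proof -
    have "(\<Sum>i<n. \<Sum>j<n. S i j * H j i) = (\<Sum>j<n. \<Sum>i<n. S i j * H j i)"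
      by (rule sum.swap)
    also have "\<dots> = (\<Sum>j<n. \<Sum>i<n. - (S j i * H j i))"
    proof (intro sum.cong refl)
      fix j i assume "j \<in> {..<n}" "i \<in> {..<n}"
      then show "S i j * H j i = - (S j i * H j i)"
        using S_skew[of j i] by simp
    qed
    finally show ?thesis by (simp add: sum_negf)
  qed
  have "2 * (\<Sum>i<n. \<Sum>j<n. Z i j * G i j) = (\<Sum>i<n. \<Sum>j<n. Z i j * (G i j + G j i))"
    using swapZ by (simp add: distrib_left sum.distrib)
  also have "\<dots> = (\<Sum>i<n. \<Sum>j<n. (if i = j then (1 + p) * Z i i else 0) + S i j * (H j i - H i j))"
  proof (intro sum.cong refl)
    fix i j assume "i \<in> {..<n}" "j \<in> {..<n}"
    then have "i < n" "j < n" by auto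
    then have "Z i j * (G i j + G j i)
      = (if i = j then (1 + p) * Z i i else 0) + S i j * (Z i j * (\<omega> j / \<omega> i - \<omega> i / \<omega> j))"
      by (simp only: G_plus_G) (simp add: algebra_simps)
    then show "Z i j * (G i j + G j i)
      = (if i = j then (1 + p) * Z i i else 0) + S i j * (H j i - H i j)"
      using \<open>i < n\<close> \<open>j < n\<close> by (simp only: Z_commutator)
  qed
  also have "\<dots> = (1 + p) * (\<Sum>i<n. Z i i) + ((\<Sum>i<n. \<Sum>j<n. S i j * H j i) - (\<Sum>i<n. \<Sum>j<n. S i j * H i j))"
    by (simp add: sum.distrib right_diff_distrib sum_subtractf sum_distrib_left)
  finally show ?thesis
    using swapS by (simp add: field_simps)
qed

section \<open>Completing the square\<close>

lemma D_times_W: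
  assumes "i < n" "j < n"
  shows "(\<Sum>k<n. D j k * W t i k) = G i j - D j i * (t / \<omega> i)"
proof -
  have "(\<Sum>k<n. D j k * W t i k) = (\<Sum>k<n. D j k * Z i k - (if i = k then D j i * (t / \<omega> i) else 0))"
    by (intro sum.cong refl) (auto simp: W_def algebra_simps)
  then show ?thesis
    using assms by (simp add: sum_subtractf G_def)
qed

text \<open>Both cross terms of the expanded form equal \<open>t / \<omega> i * G i i\<close>, and
  \<open>G_diag\<close> makes them independent of \<open>D\<close> and \<open>Z\<close>.\<close>

lemma form_W:
  assumes "i < n"
  shows "(\<Sum>j<n. W t i j * (\<Sum>k<n. D j k * W t i k))
    = (\<Sum>j<n. Z i j * G i j) - t * (1 + p) / \<omega> i + t\<^sup>2 * (D i i / (\<omega> i * \<omega> i))"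
proof -
  have "(\<Sum>j<n. W t i j * (\<Sum>k<n. D j k * W t i k))
    = (\<Sum>j<n. W t i j * (G i j - D j i * (t / \<omega> i)))"
    using assms by (intro sum.cong refl) (simp only: D_times_W lessThan_iff)
  also have "\<dots> = (\<Sum>j<n. Z i j * G i j - t / \<omega> i * (D i j * Z i j)
         - (if i = j then t / \<omega> i * (G i i - D i i * (t / \<omega> i)) else 0))"
    using assms by (intro sum.cong refl) (auto simp: W_def D_sym[of _ i] algebra_simps)
  also have "\<dots> = (\<Sum>j<n. Z i j * G i j) - t / \<omega> i * G i i - t / \<omega> i * (G i i - D i i * (t / \<omega> i))"
    using assms by (simp only: sum_subtractf sum_distrib_left[symmetric] G_def) simp
  also have "\<dots> = (\<Sum>j<n. Z i j * G i j) - t * (1 + p) / \<omega> i + t\<^sup>2 * (D i i / (\<omega> i * \<omega> i))"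
    unfolding G_diag[OF assms] using \<omega>_nz[OF assms]
    by (simp add: field_simps power2_eq_square)
  finally show ?thesis .
qed

text \<open>In the sum of \<open>form_W\<close> over the rows, \<open>energy_identity\<close>
  contributes minus the pairing of \<open>S\<close> with \<open>H\<close>, which the second form
  cancels. The value of \<open>t\<close> is chosen so that
  \<open>4 / (1 + p) * t\<^sup>2 = p / 2\<close>, the coefficient of the damping term in
  \<open>trace_eq\<close>.\<close>

lemma trace_excess:
  assumes "t\<^sup>2 = p * (1 + p) / 8"
  shows "(\<Sum>i<n. T i i) + (\<Sum>i<n. Z i i) - 4 * t * (\<Sum>i<n. 1 / \<omega> i)
    = 4 / (1 + p) * ((\<Sum>i<n. \<Sum>j<n. W t i j * (\<Sum>k<n. D j k * W t i k))
        + (\<Sum>i<n. \<Sum>j<n. S i j / \<omega> j * (\<Sum>k<n. D j k * (S i k / \<omega> k))))"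
proof -
  define z d s where "z = (\<Sum>i<n. Z i i)" "d = (\<Sum>i<n. D i i / (\<omega> i * \<omega> i))" "s = (\<Sum>i<n. 1 / \<omega> i)"
  have 1: "(\<Sum>i<n. \<Sum>j<n. S i j / \<omega> j * (\<Sum>k<n. D j k * (S i k / \<omega> k)))
    = (\<Sum>i<n. \<Sum>j<n. S i j * H i j)"
    by (simp add: H_def)
  have "(\<Sum>i<n. \<Sum>j<n. W t i j * (\<Sum>k<n. D j k * W t i k))
    = (\<Sum>i<n. \<Sum>j<n. Z i j * G i j) - t * (1 + p) * s + t\<^sup>2 * d"
  proof -
    have "(\<Sum>i<n. \<Sum>j<n. W t i j * (\<Sum>k<n. D j k * W t i k))
      = (\<Sum>i<n. (\<Sum>j<n. Z i j * G i j) - t * (1 + p) * (1 / \<omega> i) + t\<^sup>2 * (D i i / (\<omega> i * \<omega> i)))"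
      by (intro sum.cong refl) (simp add: form_W)
    then show ?thesis
      unfolding z_d_s_def by (simp only: sum.distrib sum_subtractf sum_distrib_left)
  qed
  then show ?thesis
    unfolding 1 energy_identity trace_eq[folded z_d_s_def] z_d_s_def[symmetric] assms
    using p_pos by (simp add: field_simps)
qed

lemma trace_lower_bound:
  assumes "t\<^sup>2 = p * (1 + p) / 8"
  shows "4 * t * (\<Sum>i<n. 1 / \<omega> i) \<le> (\<Sum>i<n. T i i) + (\<Sum>i<n. Z i i)"
proof -
  have "0 \<le> (\<Sum>i<n. T i i) + (\<Sum>i<n. Z i i) - 4 * t * (\<Sum>i<n. 1 / \<omega> i)"
    unfolding trace_excess[OF assms] using p_pos
    by (intro mult_nonneg_nonneg add_nonneg_nonneg sum_nonneg D_psd) auto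
  then show ?thesis by simp
qed

text \<open>Equality makes both forms in \<open>trace_excess\<close> vanish row by row, so
  \<open>D\<close> annihilates the rows of \<open>W t\<close> and of
  \<open>S \<Omega>\<^sup>-\<^sup>1\<close>. The first fact determines \<open>D\<close> up to a
  commutator of \<open>S\<close> with \<open>\<Omega>\<close>, the second removes it. Stability
  enters as \<open>obs\<close>: no nonzero eigenvector of \<open>\<Omega>\<close> lies in the kernel
  of \<open>D\<close>.\<close>

lemma trace_minimal_imp:
  assumes t: "t\<^sup>2 = p * (1 + p) / 8" "0 < t"
    and tr: "(\<Sum>i<n. T i i) + (\<Sum>i<n. Z i i) = 4 * t * (\<Sum>i<n. 1 / \<omega> i)"
    and obs: "\<And>v c. \<lbrakk>\<And>i. i < n \<Longrightarrow> \<omega> i * v i = c * v i; \<And>i. i < n \<Longrightarrow> (\<Sum>j<n. D i j * v j) = 0\<rbrakk>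
      \<Longrightarrow> \<forall>i<n. v i = 0"
    and ij: "i < n" "j < n"
  shows "D i j = (if i = j then (1 + p) / (2 * t) * \<omega> i else 0)"
proof -
  define a where "a i = (\<Sum>j<n. W t i j * (\<Sum>k<n. D j k * W t i k))" for i
  define b where "b i = (\<Sum>j<n. S i j / \<omega> j * (\<Sum>k<n. D j k * (S i k / \<omega> k)))" for i
  have nonneg: "0 \<le> a i" "0 \<le> b i" for i
    unfolding a_def b_def by (rule D_psd)+
  have "(\<Sum>i<n. a i) + (\<Sum>i<n. b i) = 0"
    using trace_excess[OF t(1)] tr p_pos unfolding a_def[symmetric] b_def[symmetric] by simp
  moreover have "0 \<le> (\<Sum>i<n. a i)" "0 \<le> (\<Sum>i<n. b i)"
    by (auto intro: sum_nonneg nonneg)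
  ultimately have "(\<Sum>i<n. a i) = 0" "(\<Sum>i<n. b i) = 0"
    by linarith+
  then have zero: "a i = 0" "b i = 0" if "i < n" for i
    using that nonneg by (auto simp: sum_nonneg_eq_0_iff)
  have DW: "(\<Sum>k<n. D j k * W t i k) = 0" if "i < n" "j < n" for i j
    using psd_form_zero_imp_kernel[of n D "W t i" j] D_sym D_psd zero(1) that by (simp add: a_def)
  have DS: "(\<Sum>k<n. D j k * (S i k / \<omega> k)) = 0" if "i < n" "j < n" for i j
    using psd_form_zero_imp_kernel[of n D "\<lambda>k. S i k / \<omega> k" j] D_sym D_psd zero(2)[of i] that
    unfolding b_def by blast
  \<comment> \<open>By \<open>DS\<close> the matrix \<open>H\<close> is zero, so
    \<open>Z_commutator\<close> leaves \<open>Z i k\<close> nonzero only where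
    \<open>\<omega> k = \<omega> i\<close>. Row \<open>i\<close> of \<open>W t\<close> is then a
    vector in the kernel of \<open>D\<close> on which \<open>\<Omega>\<close> acts as
    \<open>\<omega> i\<close>, and \<open>obs\<close> applies.\<close>
  have W0: "W t i j = 0" if "i < n" "j < n" for i j
  proof -
    have "\<forall>j<n. W t i j = 0"
    proof (rule obs)
      fix k assume k: "k < n"
      have "Z i k * (\<omega> k / \<omega> i - \<omega> i / \<omega> k) = 0"
        unfolding Z_commutator[OF \<open>i < n\<close> k] H_def DS[OF \<open>i < n\<close> k] DS[OF k \<open>i < n\<close>] by simp
      then have "Z i k = 0 \<or> \<omega> k * \<omega> k = \<omega> i * \<omega> i"
        using \<omega>_nz[OF \<open>i < n\<close>] \<omega>_nz[OF k] by (simp add: field_simps)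
      then have "Z i k = 0 \<or> \<omega> k = \<omega> i"
        using \<omega>_pos[OF \<open>i < n\<close>] \<omega>_pos[OF k]
        by (metis less_imp_le power2_eq_iff_nonneg power2_eq_square)
      then show "\<omega> k * W t i k = \<omega> i * W t i k"
        by (auto simp: W_def)
    qed (use DW that in blast)
    with that show ?thesis by blast
  qed
  \<comment> \<open>\<open>DW\<close> expresses \<open>G\<close> through \<open>D\<close> alone.
    Inserting this into \<open>G_plus_G\<close> and clearing denominators, both sides acquire the
    positive factor \<open>\<omega> i + \<omega> j\<close>, which cancels.\<close>
  have D_eq: "D i j * t = S i j * (\<omega> j - \<omega> i) + (if i = j then (1 + p) / 2 * \<omega> i else 0)"
    if "i < n" "j < n" for i j
  proof -
    have G: "G i j = D j i * (t / \<omega> i)" if "i < n" "j < n" for i j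
      using D_times_W[OF that, of t] DW[OF that] by simp
    have "D i j * t * (\<omega> i + \<omega> j) = (G i j + G j i) * (\<omega> i * \<omega> j)"
      using that G[of i j] G[of j i] D_sym[of i j] \<omega>_nz[of i] \<omega>_nz[of j] by (simp add: field_simps)
    also have "\<dots> = (S i j * (\<omega> j - \<omega> i) + (if i = j then (1 + p) / 2 * \<omega> i else 0)) * (\<omega> i + \<omega> j)"
      using that \<omega>_nz[of i] \<omega>_nz[of j] by (simp add: G_plus_G field_simps)
    finally show ?thesis
      using \<omega>_pos[of i] \<omega>_pos[of j] that by (smt (verit) mult_right_cancel)
  qed
  have "S i j * (\<omega> j - \<omega> i) = 0"
  proof -
    \<comment> \<open>The sum of \<open>f\<close> vanishes by \<open>DS\<close>. Symmetrizing
      \<open>f\<close> and inserting \<open>D_eq\<close> turns it, up to the factor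
      \<open>- t\<close>, into the weighted squares \<open>g\<close>, so every \<open>g i k\<close>
      is zero. The diagonal part of \<open>D_eq\<close> drops out because \<open>S\<close> is
      skew.\<close>
    define f where "f i k = D i k * (S i k / \<omega> k)" for i k
    define g where "g i k = (S i k * (\<omega> k - \<omega> i))\<^sup>2 / (\<omega> i * \<omega> k)" for i k
    have f0: "(\<Sum>i<n. \<Sum>k<n. f i k) = 0"
      unfolding f_def by (rule sum.neutral) (use DS in blast)
    have "(\<Sum>i<n. \<Sum>k<n. g i k) = (\<Sum>i<n. \<Sum>k<n. - (t * (f i k + f k i)))"
    proof (intro sum.cong refl)
      fix i k assume "i \<in> {..<n}" "k \<in> {..<n}"
      then have ik: "i < n" "k < n" by auto
      have "t * (f i k + f k i) = D i k * t * S i k * (1 / \<omega> k - 1 / \<omega> i)"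
        using D_sym[OF ik] S_skew[OF ik] by (simp add: f_def algebra_simps)
      also have "\<dots> = - g i k"
      proof (cases "i = k")
        case False
        have "1 / \<omega> k - 1 / \<omega> i = (\<omega> i - \<omega> k) / (\<omega> i * \<omega> k)"
          using \<omega>_nz ik by (simp add: field_simps)
        then show ?thesis
          unfolding D_eq[OF ik] g_def using False \<omega>_nz[OF ik(1)] \<omega>_nz[OF ik(2)]
          by (simp add: power2_eq_square diff_divide_distrib add_divide_distrib algebra_simps)
      qed (simp add: g_def)
      finally show "g i k = - (t * (f i k + f k i))" by simp
    qed
    also have "\<dots> = - (t * ((\<Sum>i<n. \<Sum>k<n. f i k) + (\<Sum>i<n. \<Sum>k<n. f k i)))"
      by (simp only: sum_negf sum_distrib_left sum.distrib distrib_left)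
    also have "(\<Sum>i<n. \<Sum>k<n. f k i) = (\<Sum>i<n. \<Sum>k<n. f i k)"
      by (rule sum.swap)
    finally have "(\<Sum>i<n. \<Sum>k<n. g i k) = 0"
      using f0 by simp
    moreover have g: "0 \<le> g i k" if "i < n" "k < n" for i k
      using \<omega>_pos that by (simp add: g_def less_imp_le)
    ultimately have "(\<Sum>k<n. g i k) = 0"
      using ij by (subst (asm) sum_nonneg_eq_0_iff) (auto intro: sum_nonneg)
    then have "g i j = 0"
      using ij g by (subst (asm) sum_nonneg_eq_0_iff) auto
    then show ?thesis
      using \<omega>_nz ij by (simp add: g_def)
  qed
  with D_eq[OF ij] t(2) show ?thesis
    by (auto simp: field_simps)
qed

end

section \<open>Block form of the Lyapunov equation and of stability\<close>

lemma sum_lessThan_double: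
  fixes f :: "nat \<Rightarrow> 'a :: comm_monoid_add"
  shows "(\<Sum>k<2 * n. f k) = (\<Sum>k<n. f k) + (\<Sum>k<n. f (n + k))"
proof -
  \<comment> \<open>The length \<open>m\<close> of the second half is decoupled from
    \<open>n\<close> so that induction can run on it alone.\<close>
  have "(\<Sum>k<n + m. f k) = (\<Sum>k<n. f k) + (\<Sum>k<m. f (n + k))" for m
    by (induction m) (simp_all add: add.assoc)
  from this[of n] show ?thesis by (simp add: mult_2)
qed

lemma all_less_double: "(\<forall>k<2 * n. P k) \<longleftrightarrow> (\<forall>k<n. P k) \<and> (\<forall>k<n. P (n + k))" for n :: nat
proof (intro iffI conjI allI impI; (elim conjE)?)
  fix k assume "\<forall>k<n. P k" "\<forall>k<n. P (n + k)" "k < 2 * n"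
  then show "P k"
    by (cases "k < n") (auto dest!: spec[of _ "k - n"])
qed auto

lemma mat_eq_iff_index:
  assumes "A \<in> carrier_mat nr nc" "B \<in> carrier_mat nr nc"
  shows "A = B \<longleftrightarrow> (\<forall>i<nr. \<forall>j<nc. A $$ (i, j) = B $$ (i, j))"
  using assms by (auto intro!: eq_matI)

lemma four_block_mat_eq_iff:
  assumes "A \<in> carrier_mat n n" "B \<in> carrier_mat n n" "C \<in> carrier_mat n n" "D \<in> carrier_mat n n"
    and "A' \<in> carrier_mat n n" "B' \<in> carrier_mat n n" "C' \<in> carrier_mat n n" "D' \<in> carrier_mat n n"
  shows "four_block_mat A B C D = four_block_mat A' B' C' D' \<longleftrightarrow>
    A = A' \<and> B = B' \<and> C = C' \<and> D = D'"
proof -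
  have "four_block_mat A B C D \<in> carrier_mat (2 * n) (2 * n)"
    "four_block_mat A' B' C' D' \<in> carrier_mat (2 * n) (2 * n)"
    using assms by (auto simp: mult_2)
  then have "four_block_mat A B C D = four_block_mat A' B' C' D' \<longleftrightarrow>
    (\<forall>i<2 * n. \<forall>j<2 * n. four_block_mat A B C D $$ (i, j) = four_block_mat A' B' C' D' $$ (i, j))"
    by (rule mat_eq_iff_index)
  also have "\<dots> \<longleftrightarrow> A = A' \<and> B = B' \<and> C = C' \<and> D = D'"
    unfolding all_less_double
    using assms by (auto simp: mat_eq_iff_index[of _ n n])
  finally show ?thesis .
qed

lemma index_mat_diag_mult:
  assumes "A \<in> carrier_mat n m" "i < n" "j < m"
  shows "(mat_diag n f * A) $$ (i, j) = f i * A $$ (i, j)"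
  using assms by (simp add: mat_diag_mult_left)

lemma index_mult_mat_diag:
  assumes "A \<in> carrier_mat m n" "i < m" "j < n"
  shows "(A * mat_diag n f) $$ (i, j) = A $$ (i, j) * f j"
  using assms by (simp add: mat_diag_mult_right)

lemma index_mult_mat_sum:
  assumes "A \<in> carrier_mat m n" "B \<in> carrier_mat n l" "i < m" "j < l"
  shows "(A * B) $$ (i, j) = (\<Sum>k<n. A $$ (i, k) * B $$ (k, j))"
  using assms by (auto simp: scalar_prod_def atLeast0LessThan intro: sum.cong)

lemma system_mat_carrier:
  assumes "D \<in> carrier_mat n n"
  shows "system_mat n (mat_diag n \<omega>) D \<in> carrier_mat (2 * n) (2 * n)"
  using assms by (auto simp: system_mat_def mult_2)

text \<open>The solution is not assumed symmetric, so the two off-diagonal blocks give separate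
  equations. The equivalence serves both to read equations off a given solution and to verify an
  explicit one.\<close>

lemma lyapunov_solution_four_block_iff:
  assumes D: "D \<in> carrier_mat n n" "D\<^sup>T = D"
    and X: "X1 \<in> carrier_mat n n" "X2 \<in> carrier_mat n n" "X3 \<in> carrier_mat n n" "X4 \<in> carrier_mat n n"
  shows "lyapunov_solution n p (mat_diag n \<omega>) D (four_block_mat X1 X2 X3 X4) \<longleftrightarrow>
    (\<forall>i<n. \<forall>j<n. \<omega> i * X3 $$ (i, j) + X2 $$ (i, j) * \<omega> j = (if i = j then - p else 0)) \<and>
    (\<forall>i<n. \<forall>j<n. \<omega> i * X4 $$ (i, j) - X1 $$ (i, j) * \<omega> j - (\<Sum>k<n. X2 $$ (i, k) * D $$ (k, j)) = 0) \<and>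
    (\<forall>i<n. \<forall>j<n. X4 $$ (i, j) * \<omega> j - \<omega> i * X1 $$ (i, j) - (\<Sum>k<n. D $$ (i, k) * X3 $$ (k, j)) = 0) \<and>
    (\<forall>i<n. \<forall>j<n. - (\<omega> i * X2 $$ (i, j)) - (\<Sum>k<n. D $$ (i, k) * X4 $$ (k, j))
      - X3 $$ (i, j) * \<omega> j - (\<Sum>k<n. X4 $$ (i, k) * D $$ (k, j)) = (if i = j then - 1 else 0))"
    (is "_ \<longleftrightarrow> ?E")
proof -
  define \<Omega> where "\<Omega> = mat_diag n \<omega>"
  have \<Omega>: "\<Omega> \<in> carrier_mat n n" "\<Omega>\<^sup>T = \<Omega>" by (auto simp: \<Omega>_def mat_diag_def)
  have sysT: "(system_mat n \<Omega> D)\<^sup>T = four_block_mat (0\<^sub>m n n) (- \<Omega>) \<Omega> (- D)"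
    unfolding system_mat_def using D \<Omega>
    by (subst transpose_four_block_mat[of _ n n _ n _ n]) (auto simp: transpose_uminus)
  have 1: "system_mat n \<Omega> D * four_block_mat X1 X2 X3 X4
    = four_block_mat (0\<^sub>m n n * X1 + \<Omega> * X3) (0\<^sub>m n n * X2 + \<Omega> * X4)
        (- \<Omega> * X1 + - D * X3) (- \<Omega> * X2 + - D * X4)"
    unfolding system_mat_def by (rule mult_four_block_mat) (use D \<Omega> X in auto)
  have 2: "four_block_mat X1 X2 X3 X4 * (system_mat n \<Omega> D)\<^sup>T
    = four_block_mat (X1 * 0\<^sub>m n n + X2 * \<Omega>) (X1 * - \<Omega> + X2 * - D)
        (X3 * 0\<^sub>m n n + X4 * \<Omega>) (X3 * - \<Omega> + X4 * - D)"
    unfolding sysT by (rule mult_four_block_mat) (use D \<Omega> X in auto)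
  have 3: "- four_block_mat (p \<cdot>\<^sub>m 1\<^sub>m n) (0\<^sub>m n n) (0\<^sub>m n n) (1\<^sub>m n)
    = four_block_mat (- (p \<cdot>\<^sub>m 1\<^sub>m n)) (0\<^sub>m n n) (0\<^sub>m n n) (- 1\<^sub>m n)"
    by (rule eq_matI) auto
  have "lyapunov_solution n p \<Omega> D (four_block_mat X1 X2 X3 X4) \<longleftrightarrow>
    system_mat n \<Omega> D * four_block_mat X1 X2 X3 X4 + four_block_mat X1 X2 X3 X4 * (system_mat n \<Omega> D)\<^sup>T
      = - four_block_mat (p \<cdot>\<^sub>m 1\<^sub>m n) (0\<^sub>m n n) (0\<^sub>m n n) (1\<^sub>m n)"
    unfolding lyapunov_solution_def using X by (auto simp: mult_2)
  also have "\<dots> \<longleftrightarrow>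
    (0\<^sub>m n n * X1 + \<Omega> * X3) + (X1 * 0\<^sub>m n n + X2 * \<Omega>) = - (p \<cdot>\<^sub>m 1\<^sub>m n) \<and>
    (0\<^sub>m n n * X2 + \<Omega> * X4) + (X1 * - \<Omega> + X2 * - D) = 0\<^sub>m n n \<and>
    (- \<Omega> * X1 + - D * X3) + (X3 * 0\<^sub>m n n + X4 * \<Omega>) = 0\<^sub>m n n \<and>
    (- \<Omega> * X2 + - D * X4) + (X3 * - \<Omega> + X4 * - D) = - 1\<^sub>m n"
    unfolding 1 2 3
    by (subst add_four_block_mat[of _ n n _ n _ n], (use D \<Omega> X in auto)[8],
        rule four_block_mat_eq_iff) (use D \<Omega> X in auto)
  also have "\<dots> \<longleftrightarrow>
    \<Omega> * X3 + X2 * \<Omega> = - (p \<cdot>\<^sub>m 1\<^sub>m n) \<and>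
    \<Omega> * X4 - X1 * \<Omega> - X2 * D = 0\<^sub>m n n \<and>
    X4 * \<Omega> - \<Omega> * X1 - D * X3 = 0\<^sub>m n n \<and>
    - (\<Omega> * X2) - D * X4 - X3 * \<Omega> - X4 * D = - 1\<^sub>m n"
  proof -
    have "(0\<^sub>m n n * X1 + \<Omega> * X3) + (X1 * 0\<^sub>m n n + X2 * \<Omega>) = \<Omega> * X3 + X2 * \<Omega>"
      using \<Omega> X by simp
    moreover have "(0\<^sub>m n n * X2 + \<Omega> * X4) + (X1 * - \<Omega> + X2 * - D) = \<Omega> * X4 - X1 * \<Omega> - X2 * D"
      using D \<Omega> X by (intro eq_matI) auto
    moreover have "(- \<Omega> * X1 + - D * X3) + (X3 * 0\<^sub>m n n + X4 * \<Omega>) = X4 * \<Omega> - \<Omega> * X1 - D * X3"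
      using D \<Omega> X by (intro eq_matI) auto
    moreover have "(- \<Omega> * X2 + - D * X4) + (X3 * - \<Omega> + X4 * - D) = - (\<Omega> * X2) - D * X4 - X3 * \<Omega> - X4 * D"
      using D \<Omega> X by (intro eq_matI) auto
    ultimately show ?thesis by simp
  qed
  also have "\<dots> \<longleftrightarrow> ?E"
  proof -
    \<comment> \<open>Entries of products are taken from these rules; the general product rule is
      disabled below so that factors \<open>\<Omega>\<close> collapse to scalars instead of scalar
      products.\<close>
    have index: "(\<Omega> * A) $$ (i, j) = \<omega> i * A $$ (i, j)" "(A * \<Omega>) $$ (i, j) = A $$ (i, j) * \<omega> j"
      "(D * A) $$ (i, j) = (\<Sum>k<n. D $$ (i, k) * A $$ (k, j))"
      "(A * D) $$ (i, j) = (\<Sum>k<n. A $$ (i, k) * D $$ (k, j))"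
      if "A \<in> carrier_mat n n" "i < n" "j < n" for A i j
      unfolding \<Omega>_def
      by (rule index_mat_diag_mult[OF that] index_mult_mat_diag[OF that]
          index_mult_mat_sum[OF D(1) that] index_mult_mat_sum[OF that(1) D(1) that(2,3)])+
    note dims = carrier_matD[OF D(1)] carrier_matD[OF \<Omega>(1)] carrier_matD[OF X(1)]
      carrier_matD[OF X(2)] carrier_matD[OF X(3)] carrier_matD[OF X(4)]
    note simps = index dims X D(1)
    show ?thesis
    proof (intro arg_cong2[of _ _ _ _ "(\<and>)"])
      show "\<Omega> * X3 + X2 * \<Omega> = - (p \<cdot>\<^sub>m 1\<^sub>m n) \<longleftrightarrow>
        (\<forall>i<n. \<forall>j<n. \<omega> i * X3 $$ (i, j) + X2 $$ (i, j) * \<omega> j = (if i = j then - p else 0))"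
        by (subst mat_eq_iff_index[of _ n n]) (use X \<Omega> in \<open>auto simp: simps simp del: index_mult_mat(1)\<close>)
      show "\<Omega> * X4 - X1 * \<Omega> - X2 * D = 0\<^sub>m n n \<longleftrightarrow>
        (\<forall>i<n. \<forall>j<n. \<omega> i * X4 $$ (i, j) - X1 $$ (i, j) * \<omega> j - (\<Sum>k<n. X2 $$ (i, k) * D $$ (k, j)) = 0)"
        by (subst mat_eq_iff_index[of _ n n]) (use X \<Omega> D(1) in \<open>auto simp: simps simp del: index_mult_mat(1)\<close>)
      show "X4 * \<Omega> - \<Omega> * X1 - D * X3 = 0\<^sub>m n n \<longleftrightarrow>
        (\<forall>i<n. \<forall>j<n. X4 $$ (i, j) * \<omega> j - \<omega> i * X1 $$ (i, j) - (\<Sum>k<n. D $$ (i, k) * X3 $$ (k, j)) = 0)"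
        by (subst mat_eq_iff_index[of _ n n]) (use X \<Omega> D(1) in \<open>auto simp: simps simp del: index_mult_mat(1)\<close>)
      show "- (\<Omega> * X2) - D * X4 - X3 * \<Omega> - X4 * D = - 1\<^sub>m n \<longleftrightarrow>
        (\<forall>i<n. \<forall>j<n. - (\<omega> i * X2 $$ (i, j)) - (\<Sum>k<n. D $$ (i, k) * X4 $$ (k, j))
          - X3 $$ (i, j) * \<omega> j - (\<Sum>k<n. X4 $$ (i, k) * D $$ (k, j)) = (if i = j then - 1 else 0))"
        by (subst mat_eq_iff_index[of _ n n]) (use X \<Omega> D(1) in \<open>auto simp: simps simp del: index_mult_mat(1)\<close>)
    qed
  qed
  finally show ?thesis unfolding \<Omega>_def .
qed

lemma mtrace_four_block:
  assumes "X1 \<in> carrier_mat n n" "X2 \<in> carrier_mat n n" "X3 \<in> carrier_mat n n" "X4 \<in> carrier_mat n n"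
  shows "mtrace (four_block_mat X1 X2 X3 X4) = (\<Sum>i<n. X1 $$ (i, i)) + (\<Sum>i<n. X4 $$ (i, i))"
proof -
  have "mtrace (four_block_mat X1 X2 X3 X4) = (\<Sum>i<2 * n. four_block_mat X1 X2 X3 X4 $$ (i, i))"
    using assms by (simp add: mtrace_def mult_2)
  then show ?thesis
    using assms by (simp add: sum_lessThan_double)
qed

section \<open>Eigenvalues of the system matrix in coordinates\<close>

lemma system_mat_mult_vec:
  fixes \<omega> :: "nat \<Rightarrow> real"
  assumes D: "D \<in> carrier_mat n n" and v: "v \<in> carrier_vec (2 * n)" and i: "i < n"
  defines "A \<equiv> map_mat complex_of_real (system_mat n (mat_diag n \<omega>) D)"
  shows "(A *\<^sub>v v) $ i = \<omega> i * v $ (n + i)"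
    and "(A *\<^sub>v v) $ (n + i) = - (\<omega> i * v $ i) - (\<Sum>j<n. D $$ (i, j) * v $ (n + j))"
proof -
  have A: "A \<in> carrier_mat (2 * n) (2 * n)"
    unfolding A_def using system_mat_carrier[OF D] by simp
  have entry: "(A *\<^sub>v v) $ r = (\<Sum>k<n. A $$ (r, k) * v $ k) + (\<Sum>k<n. A $$ (r, n + k) * v $ (n + k))"
    if "r < 2 * n" for r
  proof -
    have "(A *\<^sub>v v) $ r = (\<Sum>k<2 * n. A $$ (r, k) * v $ k)"
      using A v that by (auto simp: scalar_prod_def atLeast0LessThan intro: sum.cong)
    then show ?thesis by (simp add: sum_lessThan_double)
  qed
  have A_index: "A $$ (i, k) = 0" "A $$ (i, n + k) = (if i = k then \<omega> k else 0)"
    "A $$ (n + i, k) = (if i = k then - \<omega> k else 0)" "A $$ (n + i, n + k) = - D $$ (i, k)" if "k < n" for k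
    using D i that by (auto simp: A_def system_mat_def mat_diag_def)
  show "(A *\<^sub>v v) $ i = \<omega> i * v $ (n + i)"
    using i by (simp add: entry A_index if_distrib[of "\<lambda>x. x * _"] if_distrib[of complex_of_real] cong: if_cong)
  show "(A *\<^sub>v v) $ (n + i) = - (\<omega> i * v $ i) - (\<Sum>j<n. D $$ (i, j) * v $ (n + j))"
    using i by (simp add: entry A_index if_distrib[of "\<lambda>x. x * _"] if_distrib[of complex_of_real] sum_negf cong: if_cong)
qed

text \<open>Splitting an eigenvector into its position half \<open>a\<close> and velocity half
  \<open>b\<close> reduces stability to \<open>n\<close> scalar pairs of equations, coupled only
  through \<open>D\<close>.\<close>

lemma eigenvalue_system_mat_iff:
  fixes \<omega> :: "nat \<Rightarrow> real" and k :: complex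
  assumes D: "D \<in> carrier_mat n n"
  shows "eigenvalue (map_mat complex_of_real (system_mat n (mat_diag n \<omega>) D)) k \<longleftrightarrow>
    (\<exists>(a :: nat \<Rightarrow> complex) (b :: nat \<Rightarrow> complex). (\<exists>i<n. a i \<noteq> 0 \<or> b i \<noteq> 0) \<and> (\<forall>i<n. \<omega> i * b i = k * a i) \<and>
      (\<forall>i<n. - (\<omega> i * a i) - (\<Sum>j<n. D $$ (i, j) * b j) = k * b i))"
proof -
  let ?A = "map_mat complex_of_real (system_mat n (mat_diag n \<omega>) D)"
  let ?P = "\<lambda>(a :: nat \<Rightarrow> complex) (b :: nat \<Rightarrow> complex). (\<exists>i<n. a i \<noteq> 0 \<or> b i \<noteq> 0) \<and> (\<forall>i<n. \<omega> i * b i = k * a i) \<and>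
      (\<forall>i<n. - (\<omega> i * a i) - (\<Sum>j<n. D $$ (i, j) * b j) = k * b i)"
  have A: "?A \<in> carrier_mat (2 * n) (2 * n)"
    using system_mat_carrier[OF D] by simp
  have key: "eigenvector ?A v k \<longleftrightarrow> ?P (\<lambda>i. v $ i) (\<lambda>i. v $ (n + i))"
    if v: "v \<in> carrier_vec (2 * n)" for v
  proof -
    have "v \<noteq> 0\<^sub>v (2 * n) \<longleftrightarrow> \<not> (\<forall>i<2 * n. v $ i = 0)"
      using v by (auto intro!: eq_vecI)
    moreover have "?A *\<^sub>v v = k \<cdot>\<^sub>v v \<longleftrightarrow> (\<forall>i<2 * n. (?A *\<^sub>v v) $ i = k * v $ i)"
      using v A by (auto intro!: eq_vecI simp del: index_mult_mat_vec)
    ultimately show ?thesis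
      using v A unfolding eigenvector_def all_less_double
      by (auto simp: system_mat_mult_vec[OF D v] simp del: index_mult_mat_vec)
  qed
  show ?thesis
  proof
    assume "eigenvalue ?A k"
    then obtain v where v: "eigenvector ?A v k" by (auto simp: eigenvalue_def)
    then have "v \<in> carrier_vec (2 * n)" using A by (auto simp: eigenvector_def)
    from iffD1[OF key[OF this] v] show "\<exists>a b. ?P a b"
      by (intro exI)
  next
    assume "\<exists>a b. ?P a b"
    then obtain a b where P: "?P a b" by blast
    define v where "v = vec (2 * n) (\<lambda>i. if i < n then a i else b (i - n))"
    have v: "v \<in> carrier_vec (2 * n)" by (simp add: v_def)
    have ab: "v $ i = a i" "v $ (n + i) = b i" if "i < n" for i
      using that by (auto simp: v_def)
    have "?P (\<lambda>i. v $ i) (\<lambda>i. v $ (n + i))"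
      using P by (simp add: ab cong: conj_cong)
    then show "eigenvalue ?A k"
      unfolding eigenvalue_def using iffD2[OF key[OF v]] by (intro exI[of _ v])
  qed
qed

text \<open>If \<open>v\<close> is an eigenvector of \<open>\<Omega>\<close> for \<open>c\<close> that is not damped, then \<open>(v, \<i> v)\<close> is an eigenvector
  of the system matrix for the eigenvalue \<open>\<i> c\<close>.\<close>

lemma stable_no_undamped_mode:
  assumes D: "D \<in> carrier_mat n n"
    and stable: "stable_mat (system_mat n (mat_diag n \<omega>) D)"
    and ev: "\<And>i. i < n \<Longrightarrow> \<omega> i * v i = c * v i"
    and ker: "\<And>i. i < n \<Longrightarrow> (\<Sum>j<n. D $$ (i, j) * v j) = 0"
  shows "\<forall>i<n. v i = 0"
proof (rule ccontr)
  assume "\<not> ?thesis"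
  then obtain i0 where i0: "i0 < n" "v i0 \<noteq> 0" by auto
  have "eigenvalue (map_mat complex_of_real (system_mat n (mat_diag n \<omega>) D)) (\<i> * c)"
    unfolding eigenvalue_system_mat_iff[OF D]
  proof (intro exI conjI allI impI)
    show "i0 < n" by fact
    show "complex_of_real (v i0) \<noteq> 0 \<or> \<i> * complex_of_real (v i0) \<noteq> 0" using i0 by simp
    fix i assume i: "i < n"
    have ev': "complex_of_real (\<omega> i) * v i = c * v i"
      using ev[OF i] by (metis of_real_mult)
    then show "\<omega> i * (\<i> * complex_of_real (v i)) = \<i> * c * complex_of_real (v i)"
      by (simp add: mult.left_commute mult.assoc)
    have "(\<Sum>j<n. D $$ (i, j) * (\<i> * complex_of_real (v j))) = \<i> * complex_of_real (\<Sum>j<n. D $$ (i, j) * v j)"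
      by (simp add: sum_distrib_left mult.left_commute)
    also have "\<dots> = 0" by (simp only: ker[OF i]) simp
    finally have sum0: "(\<Sum>j<n. D $$ (i, j) * (\<i> * complex_of_real (v j))) = 0" .
    have "\<i> * c * (\<i> * complex_of_real (v i)) = \<i> * \<i> * (c * complex_of_real (v i))"
      by (simp only: mult_ac)
    also have "\<dots> = - (c * complex_of_real (v i))"
      by simp
    finally have "\<i> * c * (\<i> * complex_of_real (v i)) = - (c * complex_of_real (v i))" .
    then show "- (\<omega> i * complex_of_real (v i)) - (\<Sum>j<n. D $$ (i, j) * (\<i> * complex_of_real (v j)))
      = \<i> * c * (\<i> * complex_of_real (v i))"
      unfolding sum0 ev' by simp
  qed
  with stable have "Re (\<i> * c) < 0" unfolding stable_mat_def by blast
  then show False by simp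
qed

text \<open>The system decouples into scalar oscillators, so an eigenvalue \<open>k\<close> is a
  root of \<open>k * k + c * \<omega> i * k + \<omega> i * \<omega> i\<close> for some
  \<open>i\<close>. A nonreal root has real part \<open>- c * \<omega> i / 2\<close>; a real one is
  negative because all coefficients are positive.\<close>

lemma stable_diagonal_damping:
  assumes \<omega>: "\<forall>i<n. 0 < \<omega> i" and c: "0 < c"
  shows "stable_mat (system_mat n (mat_diag n \<omega>) (c \<cdot>\<^sub>m mat_diag n \<omega>))"
proof -
  let ?D = "c \<cdot>\<^sub>m mat_diag n \<omega>"
  have D: "?D \<in> carrier_mat n n" by simp
  have "Re k < 0"
    if ev: "eigenvalue (map_mat complex_of_real (system_mat n (mat_diag n \<omega>) ?D)) k" for k
  proof -
    obtain a b :: "nat \<Rightarrow> complex" and i where i: "i < n" "a i \<noteq> 0 \<or> b i \<noteq> 0"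
      and 1: "\<forall>i<n. \<omega> i * b i = k * a i"
      and 2: "\<forall>i<n. - (\<omega> i * a i) - (\<Sum>j<n. ?D $$ (i, j) * b j) = k * b i"
      using ev unfolding eigenvalue_system_mat_iff[OF D] by blast
    have w: "0 < \<omega> i" using \<omega> i by simp
    have "(\<Sum>j<n. ?D $$ (i, j) * b j) = (\<Sum>j<n. if i = j then c * \<omega> j * b j else 0)"
      using i by (intro sum.cong refl) (auto simp: mat_diag_def)
    also have "\<dots> = c * \<omega> i * b i" using i by simp
    finally have b2: "- (\<omega> i * a i) - c * \<omega> i * b i = k * b i"
      using 2[rule_format, OF i(1)] by (simp only:)
    have b1: "\<omega> i * b i = k * a i" using 1 i by simp
    have "a i \<noteq> 0" using i b1 w by auto
    moreover have "a i * (k * k + c * \<omega> i * k + \<omega> i * \<omega> i) = 0"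
    proof -
      have "a i * (k * k + c * \<omega> i * k + \<omega> i * \<omega> i) = k * (k * a i) + c * \<omega> i * (k * a i) + \<omega> i * \<omega> i * a i"
        by (simp add: algebra_simps)
      also have "\<dots> = \<omega> i * (k * b i - (- (\<omega> i * a i) - c * \<omega> i * b i))"
        unfolding b1[symmetric] by (simp add: algebra_simps)
      finally show ?thesis using b2 by simp
    qed
    ultimately have "k * k + c * \<omega> i * k + \<omega> i * \<omega> i = 0" by simp
    then have re: "Re k * Re k - Im k * Im k + c * \<omega> i * Re k + \<omega> i * \<omega> i = 0"
      and im: "Im k * (2 * Re k + c * \<omega> i) = 0"
      by (simp_all add: complex_eq_iff algebra_simps)
    have cw: "0 < c * \<omega> i" using c w by simp
    show "Re k < 0"
    proof (cases "Im k = 0")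
      case True
      show ?thesis
      proof (rule ccontr)
        assume "\<not> Re k < 0"
        then have "0 \<le> c * \<omega> i * Re k" using cw by simp
        moreover have "0 \<le> Re k * Re k" "0 < \<omega> i * \<omega> i" using w by auto
        moreover have "Re k * Re k + c * \<omega> i * Re k + \<omega> i * \<omega> i = 0" using re True by simp
        ultimately show False by linarith
      qed
    next
      case False
      then show ?thesis using im cw by simp
    qed
  qed
  then show ?thesis
    using carrier_matD[OF system_mat_carrier[OF D, of \<omega>]] unfolding stable_mat_def by simp
qed

section \<open>Optimal damping\<close>

lemma sym_pos_semidef_form:
  assumes "sym_pos_semidef n D"
  shows "0 \<le> (\<Sum>i<n. x i * (\<Sum>j<n. D $$ (i, j) * x j))"
proof -
  have D: "D \<in> carrier_mat n n" using assms by (simp add: sym_pos_semidef_def)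
  have "0 \<le> vec n x \<bullet> (D *\<^sub>v vec n x)"
    using assms by (simp add: sym_pos_semidef_def)
  also have "\<dots> = (\<Sum>i<n. x i * (\<Sum>j<n. D $$ (i, j) * x j))"
    using D by (auto simp: scalar_prod_def atLeast0LessThan intro!: sum.cong)
  finally show ?thesis .
qed

lemma sym_pos_semidef_mat_diag:
  assumes "\<forall>i<n. 0 \<le> f i"
  shows "sym_pos_semidef n (mat_diag n f)"
proof -
  have "0 \<le> x \<bullet> (mat_diag n f *\<^sub>v x)" if x: "x \<in> carrier_vec n" for x
  proof -
    have "x \<bullet> (mat_diag n f *\<^sub>v x) = (\<Sum>i<n. x $ i * (\<Sum>j<n. mat_diag n f $$ (i, j) * x $ j))"
      using x carrier_matD[OF mat_diag_dim[of n f]]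
      by (auto simp: scalar_prod_def atLeast0LessThan intro!: sum.cong)
    also have "\<dots> = (\<Sum>i<n. f i * (x $ i)\<^sup>2)"
      by (auto simp: mat_diag_def power2_eq_square if_distrib[of "\<lambda>y. y * _"] cong: if_cong
          intro!: sum.cong)
    also have "0 \<le> \<dots>"
      using assms by (intro sum_nonneg) auto
    finally show ?thesis .
  qed
  moreover have "(mat_diag n f)\<^sup>T = mat_diag n f"
    by (auto simp: mat_diag_def)
  ultimately show ?thesis by (simp add: sym_pos_semidef_def)
qed

text \<open>The blocks of the symmetric part \<open>(X + X\<^sup>T) / 2\<close>, which solves the same Lyapunov equation and
  has the same trace; this makes the uniqueness of \<open>X\<close> dispensable.\<close>

lemma symmetrized_solution_blocks:
  assumes \<omega>: "\<forall>i<n. 0 < \<omega> i" and p: "0 < p"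
    and D: "sym_pos_semidef n D"
    and sol: "lyapunov_solution n p (mat_diag n \<omega>) D X"
  obtains T Y Z where "lyapunov_blocks n \<omega> p (\<lambda>i j. D $$ (i, j)) T Y Z"
    and "mtrace X = (\<Sum>i<n. T i i) + (\<Sum>i<n. Z i i)"
proof -
  have Dc: "D \<in> carrier_mat n n" and DT: "D\<^sup>T = D"
    using D by (auto simp: sym_pos_semidef_def)
  have D_sym: "D $$ (i, j) = D $$ (j, i)" if "i < n" "j < n" for i j
    using Dc DT that by (metis carrier_matD index_transpose_mat(1))
  have "X \<in> carrier_mat (n + n) (n + n)"
    using sol by (simp add: lyapunov_solution_def mult_2)
  then obtain X1 X2 X3 X4 where X: "X1 \<in> carrier_mat n n" "X2 \<in> carrier_mat n n"
    "X3 \<in> carrier_mat n n" "X4 \<in> carrier_mat n n" and X_eq: "X = four_block_mat X1 X2 X3 X4"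
    using split_block[of X n n] by (metis carrier_matD prod_cases4)
  note E = sol[unfolded X_eq lyapunov_solution_four_block_iff[OF Dc DT X]]
  define T where "T i j = (X1 $$ (i, j) + X1 $$ (j, i)) / 2" for i j
  \<comment> \<open>Transposing \<open>X\<close> exchanges the off-diagonal blocks, so
    \<open>X2\<close> is averaged with the transpose of \<open>X3\<close>.\<close>
  define Y where "Y i j = (X2 $$ (i, j) + X3 $$ (j, i)) / 2" for i j
  define Z where "Z i j = (X4 $$ (i, j) + X4 $$ (j, i)) / 2" for i j
  have blocks: "lyapunov_blocks n \<omega> p (\<lambda>i j. D $$ (i, j)) T Y Z"
  proof
    fix i j assume ij: "i < n" "j < n"
    show "\<omega> i * Y j i + Y i j * \<omega> j = (if i = j then - p else 0)"
    proof -
      have "\<omega> i * X3 $$ (i, j) + X2 $$ (i, j) * \<omega> j = (if i = j then - p else 0)"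
        "\<omega> j * X3 $$ (j, i) + X2 $$ (j, i) * \<omega> i = (if i = j then - p else 0)"
        using E ij by auto
      then show ?thesis by (simp add: Y_def field_simps split: if_splits)
    qed
    \<comment> \<open>This is the average of the upper right equation and the transposed lower left
      one; symmetry of \<open>D\<close> aligns the two sums.\<close>
    show "\<omega> i * Z i j - T i j * \<omega> j - (\<Sum>k<n. Y i k * D $$ (k, j)) = 0"
    proof -
      have "\<omega> i * X4 $$ (i, j) - X1 $$ (i, j) * \<omega> j - (\<Sum>k<n. X2 $$ (i, k) * D $$ (k, j)) = 0"
        "X4 $$ (j, i) * \<omega> i - \<omega> j * X1 $$ (j, i) - (\<Sum>k<n. D $$ (j, k) * X3 $$ (k, i)) = 0"
        using E ij by auto
      moreover have "(\<Sum>k<n. D $$ (j, k) * X3 $$ (k, i)) = (\<Sum>k<n. X3 $$ (k, i) * D $$ (k, j))"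
        using D_sym[OF ij(2)] by (intro sum.cong refl) simp
      moreover have "(\<Sum>k<n. Y i k * D $$ (k, j))
        = ((\<Sum>k<n. X2 $$ (i, k) * D $$ (k, j)) + (\<Sum>k<n. X3 $$ (k, i) * D $$ (k, j))) / 2"
        by (simp add: Y_def sum.distrib[symmetric] sum_divide_distrib algebra_simps)
      ultimately show ?thesis by (simp add: Z_def T_def field_simps)
    qed
    show "- (\<omega> i * Y i j) - (\<Sum>k<n. D $$ (i, k) * Z k j) - Y j i * \<omega> j - (\<Sum>k<n. Z i k * D $$ (k, j))
      = (if i = j then - 1 else 0)"
    proof -
      have "- (\<omega> i * X2 $$ (i, j)) - (\<Sum>k<n. D $$ (i, k) * X4 $$ (k, j))
          - X3 $$ (i, j) * \<omega> j - (\<Sum>k<n. X4 $$ (i, k) * D $$ (k, j)) = (if i = j then - 1 else 0)"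
        "- (\<omega> j * X2 $$ (j, i)) - (\<Sum>k<n. D $$ (j, k) * X4 $$ (k, i))
          - X3 $$ (j, i) * \<omega> i - (\<Sum>k<n. X4 $$ (j, k) * D $$ (k, i)) = (if i = j then - 1 else 0)"
        using E ij by auto
      moreover have "(\<Sum>k<n. D $$ (j, k) * X4 $$ (k, i)) = (\<Sum>k<n. X4 $$ (k, i) * D $$ (k, j))"
        "(\<Sum>k<n. X4 $$ (j, k) * D $$ (k, i)) = (\<Sum>k<n. D $$ (i, k) * X4 $$ (j, k))"
        using D_sym[OF ij(2)] D_sym[OF ij(1)] by (auto intro!: sum.cong)
      moreover have "(\<Sum>k<n. D $$ (i, k) * Z k j)
          = ((\<Sum>k<n. D $$ (i, k) * X4 $$ (k, j)) + (\<Sum>k<n. D $$ (i, k) * X4 $$ (j, k))) / 2"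
        "(\<Sum>k<n. Z i k * D $$ (k, j))
          = ((\<Sum>k<n. X4 $$ (i, k) * D $$ (k, j)) + (\<Sum>k<n. X4 $$ (k, i) * D $$ (k, j))) / 2"
        by (simp_all add: Z_def sum.distrib[symmetric] sum_divide_distrib algebra_simps)
      ultimately show ?thesis
        by (cases "i = j") (simp_all add: Y_def field_simps)
    qed
  qed (use \<omega> p D_sym sym_pos_semidef_form[OF D] in \<open>auto simp: T_def Z_def\<close>)
  show thesis
    by (rule that[OF blocks]) (simp add: X_eq mtrace_four_block[OF X] T_def Z_def)
qed

text \<open>The witness comes from setting \<open>S = 0\<close> and
  \<open>Z = t \<Omega>\<^sup>-\<^sup>1\<close> in \<open>Y_eq\<close> and \<open>T_eq\<close>. The
  upper left entries are \<open>3 * t / \<omega> i\<close> because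
  \<open>p * (1 + p) / (4 * t) = 2 * t\<close>.\<close>

lemma diagonal_damping_solution:
  assumes \<omega>: "\<forall>i<n. 0 < \<omega> i" and p: "0 < p" and t: "t\<^sup>2 = p * (1 + p) / 8" "0 < t"
  obtains X where "lyapunov_solution n p (mat_diag n \<omega>) ((1 + p) / (2 * t) \<cdot>\<^sub>m mat_diag n \<omega>) X"
    and "mtrace X = 4 * t * (\<Sum>i<n. 1 / \<omega> i)"
proof
  define X1 where "X1 = mat_diag n (\<lambda>i. 3 * t / \<omega> i)"
  define X2 where "X2 = mat_diag n (\<lambda>i. - p / 2 / \<omega> i)"
  define X4 where "X4 = mat_diag n (\<lambda>i. t / \<omega> i)"
  let ?D = "(1 + p) / (2 * t) \<cdot>\<^sub>m mat_diag n \<omega>"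
  have D: "?D \<in> carrier_mat n n" "?D\<^sup>T = ?D"
    by (simp, auto simp: mat_diag_def)
  have X: "X1 \<in> carrier_mat n n" "X2 \<in> carrier_mat n n" "X4 \<in> carrier_mat n n"
    by (auto simp: X1_def X2_def X4_def)
  have prod: "(\<Sum>k<n. mat_diag n f $$ (i, k) * ?D $$ (k, j)) = (if i = j then f i * ((1 + p) / (2 * t) * \<omega> i) else 0)"
    "(\<Sum>k<n. ?D $$ (i, k) * mat_diag n f $$ (k, j)) = (if i = j then f i * ((1 + p) / (2 * t) * \<omega> i) else 0)"
    if "i < n" "j < n" for f i j
  proof -
    have "(\<Sum>k<n. mat_diag n f $$ (i, k) * ?D $$ (k, j))
      = (\<Sum>k<n. if i = k then mat_diag n f $$ (i, i) * ?D $$ (i, j) else 0)"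
      using that by (intro sum.cong refl) (auto simp: mat_diag_def)
    then show "(\<Sum>k<n. mat_diag n f $$ (i, k) * ?D $$ (k, j))
      = (if i = j then f i * ((1 + p) / (2 * t) * \<omega> i) else 0)"
      using that by (simp add: mat_diag_def)
    have "(\<Sum>k<n. ?D $$ (i, k) * mat_diag n f $$ (k, j))
      = (\<Sum>k<n. if i = k then ?D $$ (i, i) * mat_diag n f $$ (i, j) else 0)"
      using that by (intro sum.cong refl) (auto simp: mat_diag_def)
    then show "(\<Sum>k<n. ?D $$ (i, k) * mat_diag n f $$ (k, j))
      = (if i = j then f i * ((1 + p) / (2 * t) * \<omega> i) else 0)"
      using that by (simp add: mat_diag_def)
  qed
  \<comment> \<open>The relation for \<open>t\<^sup>2\<close>, in the shape that
    \<open>field_simps\<close> produces below.\<close>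
  have t8: "t * (t * (x * 8)) = p * x + p * (p * x)" for x
  proof -
    have "t * (t * (x * 8)) = 8 * t\<^sup>2 * x"
      by (simp add: power2_eq_square)
    then show ?thesis
      by (simp add: t(1) algebra_simps)
  qed
  have \<omega>_nz: "\<omega> i \<noteq> 0" if "i < n" for i using \<omega> that by fastforce
  show "lyapunov_solution n p (mat_diag n \<omega>) ?D (four_block_mat X1 X2 X2 X4)"
    unfolding lyapunov_solution_four_block_iff[OF D X(1,2,2,3)]
    unfolding X1_def X2_def X4_def
    apply (simp only: prod cong: imp_cong)
    using \<omega>_nz t(2)
    by (auto simp: mat_diag_def field_simps t8)
  show "mtrace (four_block_mat X1 X2 X2 X4) = 4 * t * (\<Sum>i<n. 1 / \<omega> i)"
    unfolding mtrace_four_block[OF X(1,2,2,3)]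
    by (simp add: X1_def X4_def mat_diag_def sum.distrib[symmetric] sum_distrib_left)
qed

theorem theorem4p2:
  fixes n :: nat and M K L1 L2 L2inv U1 U2 \<Omega> :: "real mat" and \<omega> :: "nat \<Rightarrow> real" and p :: real
  assumes "sym_pos_def n M" and "sym_pos_def n K"
    and "cholesky_factor n M L2" and "cholesky_factor n K L1"
    and "L2inv \<in> carrier_mat n n" and "inverts_mat L2 L2inv" and "inverts_mat L2inv L2"
    and "orthonormal_mat n U1" and "orthonormal_mat n U2"
    and "\<Omega> = mat_diag n \<omega>" and "\<forall>i<n. \<omega> i > 0"
    and "L2inv * L1 = U2 * \<Omega> * U1\<^sup>T"
    and "0 < p" and "p < 1"
  shows "(\<exists>!D. optimal_damping n p \<Omega> D) \<and>
         optimal_damping n p \<Omega> (sqrt (2 * (1 + p) / p) \<cdot>\<^sub>m \<Omega>)"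
proof -
  note \<Omega> = \<open>\<Omega> = mat_diag n \<omega>\<close> and \<omega> = \<open>\<forall>i<n. \<omega> i > 0\<close> and p = \<open>0 < p\<close>
  define t where "t = sqrt (p * (1 + p) / 8)"
  have t: "t\<^sup>2 = p * (1 + p) / 8" "0 < t" using p by (simp_all add: t_def)
  define s where "s = (\<Sum>i<n. 1 / \<omega> i)"
  define D0 where "D0 = (1 + p) / (2 * t) \<cdot>\<^sub>m \<Omega>"
  \<comment> \<open>The coefficient in the statement is the one found in
    \<open>trace_minimal_imp\<close>; their squares agree by the choice of \<open>t\<close>.\<close>
  have "sqrt (2 * (1 + p) / p) = (1 + p) / (2 * t)"
  proof (rule real_sqrt_unique)
    show "((1 + p) / (2 * t))\<^sup>2 = 2 * (1 + p) / p"
    proof -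
      have "((1 + p) / (2 * t))\<^sup>2 = (1 + p) * (1 + p) / ((1 + p) * (p / 2))"
        by (simp add: power_divide power_mult_distrib t(1)) (simp add: power2_eq_square)
      also have "\<dots> = 2 * (1 + p) / p"
        using p by (subst mult_divide_mult_cancel_left) auto
      finally show ?thesis .
    qed
    show "0 \<le> (1 + p) / (2 * t)" using p t(2) by simp
  qed
  then have D0: "sqrt (2 * (1 + p) / p) \<cdot>\<^sub>m \<Omega> = D0" by (simp add: D0_def)
  have bound: "4 * t * s \<le> mtrace X"
    and equality: "mtrace X = 4 * t * s \<Longrightarrow> D = D0"
    if D: "D \<in> stable_dampings n \<Omega>" and X: "lyapunov_solution n p \<Omega> D X" for D X
  proof -
    have psd: "sym_pos_semidef n D" and stable: "stable_mat (system_mat n (mat_diag n \<omega>) D)"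
      using D by (auto simp: stable_dampings_def \<Omega>)
    then have Dc: "D \<in> carrier_mat n n" by (simp add: sym_pos_semidef_def)
    obtain T Y Z where blocks: "lyapunov_blocks n \<omega> p (\<lambda>i j. D $$ (i, j)) T Y Z"
      and tr: "mtrace X = (\<Sum>i<n. T i i) + (\<Sum>i<n. Z i i)"
      using symmetrized_solution_blocks[OF \<omega> p psd] X unfolding \<Omega> by blast
    show "4 * t * s \<le> mtrace X"
      unfolding tr s_def by (rule lyapunov_blocks.trace_lower_bound[OF blocks t(1)])
    assume min: "mtrace X = 4 * t * s"
    have "D $$ (i, j) = (if i = j then (1 + p) / (2 * t) * \<omega> i else 0)" if "i < n" "j < n" for i j
      using min that unfolding tr s_def
      by (intro lyapunov_blocks.trace_minimal_imp[OF blocks t] stable_no_undamped_mode[OF Dc stable])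
    then show "D = D0"
      using Dc by (intro eq_matI) (auto simp: D0_def \<Omega> mat_diag_def)
  qed
  obtain X0 where X0: "lyapunov_solution n p \<Omega> D0 X0" "mtrace X0 = 4 * t * s"
    using diagonal_damping_solution[OF \<omega> p t] unfolding D0_def \<Omega> s_def by blast
  have feasible: "D0 \<in> stable_dampings n \<Omega>"
  proof -
    have "D0 = mat_diag n (\<lambda>i. (1 + p) / (2 * t) * \<omega> i)"
      by (auto simp: D0_def \<Omega> mat_diag_def)
    then have "sym_pos_semidef n D0"
      using \<omega> p t(2) by (auto intro!: sym_pos_semidef_mat_diag simp: less_imp_le)
    then show ?thesis
      using stable_diagonal_damping[OF \<omega>, of "(1 + p) / (2 * t)"] p t(2)
      by (simp add: stable_dampings_def D0_def \<Omega>)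
  qed
  \<comment> \<open>The pair \<open>D0\<close>, \<open>X0\<close> is feasible and attains the lower
    bound. Any optimal pair must therefore attain it too, and \<open>equality\<close> identifies its
    damping.\<close>
  have "optimal_damping n p \<Omega> D \<longleftrightarrow> D = D0" for D
  proof
    assume "optimal_damping n p \<Omega> D"
    then obtain X where X: "D \<in> stable_dampings n \<Omega>" "lyapunov_solution n p \<Omega> D X"
      and "\<not> sqrt (mtrace X0) < sqrt (mtrace X)"
      unfolding optimal_damping_def is_arg_min_def using feasible X0(1) by fastforce
    then have "mtrace X = 4 * t * s"
      using bound[OF X] X0(2) by simp
    then show "D = D0" by (rule equality[OF X])
  next
    assume "D = D0"
    then show "optimal_damping n p \<Omega> D"
      unfolding optimal_damping_def is_arg_min_def
      using feasible X0 bound by (intro exI[of _ X0]) (force simp: not_less)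
  qed
  then show ?thesis unfolding D0 by simp
qed

end
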